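(* For every integer $k\geq1$ there is a constant $c_k>0$ such that for every finite set $A\subset\mathbb{C}$, $$|4^{k-1}A^{(k)}|\geq c_k|A|^k.$$
   Context: For a finite set $X\subset\mathbb{C}$ and an integer $m\ge1$, $mX:=\{x_1+\cdots+x_m: x_1,\dots,x_m\in X\}$ is the $m$-fold sum set and $X^{(m)}:=\{x_1\cdots x_m: x_1,\dots,x_m\in X\}$ the $m$-fold product set. Thus $4^{k-1}A^{(k)}$ is the $4^{k-1}$-fold sum set of the $k$-fold product set of $A$. *)

theory Defs
  imports Complex_Main
begin

fun sumset :: "nat \<Rightarrow> complex set \<Rightarrow> complex set" where
  "sumset 0 X = {0}"
| "sumset (Suc m) X = {x + y | x y. x \<in> X \<and> y \<in> sumset m X}"

fun prodset :: "nat \<Rightarrow> complex set \<Rightarrow> complex set" where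
  "prodset 0 X = {1}"
| "prodset (Suc m) X = {x * y | x y. x \<in> X \<and> y \<in> prodset m X}"

end

theory Submission
  imports Defs "HOL-Analysis.Analysis"
begin

text \<open>
  Over the positive reals one argues as Solymosi did: summing points taken on two consecutive lines
  through the origin gives points strictly between these lines, so different pairs of consecutive
  lines do not interfere. Over the complex numbers a slope is paired with its nearest neighbour
  instead. If \<open>A\<close> lies in a narrow sector, then the sum of a point of slope \<open>r\<close> and a point whose slope
  \<open>s\<close> is nearest to \<open>r\<close> has a slope that is closer to \<open>r\<close> than any other slope is, and every complex
  number has this property for boundedly many \<open>r\<close> only. Applied to \<open>A \<times> A\<close> this shows that the set
  \<open>R\<close> of ratios \<open>(a + b) / (c + d)\<close> has size \<open>\<ge> |A|\<^sup>2 / C\<close>. Applied to the points \<open>\<lambda> v\<close>, where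
  \<open>\<lambda> \<in> B = 4\<^sup>k\<^sup>-\<^sup>1A\<^sup>(\<^sup>k\<^sup>)\<close> and \<open>v \<in> (A + A)\<^sup>2\<close> runs through one vector for every slope in \<open>R\<close>, it shows
  that \<open>(4\<^sup>kA\<^sup>(\<^sup>k\<^sup>+\<^sup>1\<^sup>))\<^sup>2\<close> has size \<open>\<ge> |R| |B|\<^sup>2 / C\<close>, whence \<open>|4\<^sup>kA\<^sup>(\<^sup>k\<^sup>+\<^sup>1\<^sup>)| \<ge> |A| |B| / C\<close>. A
  general \<open>A\<close> has a proportional part in a rotated sector.
\<close>

section \<open>Nearest neighbours in the plane\<close>

text \<open>Compactness of the circle. The net serves at scale 1/2 to count directions and at scale
  \<delta>/2 to cut the punctured plane into sectors.\<close>

lemma finite_net_unit_circle: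
  fixes e :: real
  assumes "e > 0"
  obtains F :: "complex set" where "finite F" "\<And>f. f \<in> F \<Longrightarrow> norm f = 1"
    "\<And>z. z \<noteq> 0 \<Longrightarrow> \<exists>f\<in>F. dist f (sgn z) < e"
proof -
  have "open (ball x e)" "sphere 0 1 \<subseteq> (\<Union>x\<in>sphere 0 1. ball x e)" for x :: complex
    using assms by auto
  from compactE_image[OF compact_sphere this] obtain F
    where F: "F \<subseteq> sphere (0::complex) 1" "finite F" "sphere 0 1 \<subseteq> (\<Union>x\<in>F. ball x e)"
    by blast
  show thesis
  proof (rule that[OF F(2)])
    show "norm f = 1" if "f \<in> F" for f using F(1) that by auto
    show "\<exists>f\<in>F. dist f (sgn z) < e" if "z \<noteq> 0" for z
    proof -
      have "sgn z \<in> sphere 0 1" using that by (simp add: norm_sgn)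
      then show ?thesis using F(3) by (auto simp: subset_iff)
    qed
  qed
qed

text \<open>A normed-space form of the fact that the side opposite an angle below 60 degrees is not
  the longest one: first shrink the longer vector to the length of the shorter, then turn
  it.\<close>

lemma dist_less_max_norm:
  fixes u v :: "'a::real_normed_vector"
  assumes "u \<noteq> 0" "v \<noteq> 0" "dist (sgn u) (sgn v) < 1"
  shows "dist u v < max (norm u) (norm v)"
proof -
  have *: "dist u v < norm v" if "u \<noteq> 0" "norm u \<le> norm v" "dist (sgn u) (sgn v) < 1" for u v :: 'a
  proof -
    have u: "u = norm u *\<^sub>R sgn u" and v: "v = norm v *\<^sub>R sgn v" 
      using that by (cases "v = 0"; simp add: sgn_div_norm)+
    have "u - v = norm u *\<^sub>R (sgn u - sgn v) - (norm v - norm u) *\<^sub>R sgn v"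
      using u v by (simp add: algebra_simps)
    then have "norm (u - v) \<le> norm u * norm (sgn u - sgn v) + (norm v - norm u) * norm (sgn v)"
      using that norm_triangle_ineq4[of "norm u *\<^sub>R (sgn u - sgn v)" "(norm v - norm u) *\<^sub>R sgn v"]
      by simp
    also have "(norm v - norm u) * norm (sgn v) \<le> (norm v - norm u) * 1"
      using that by (intro mult_left_mono) (auto simp: norm_sgn)
    also have "norm u * norm (sgn u - sgn v) < norm u * 1"
      using that by (intro mult_strict_left_mono) (auto simp: dist_norm)
    finally show ?thesis by (simp add: dist_norm)
  qed
  show ?thesis
  proof (cases "norm u \<le> norm v")
    case True
    then show ?thesis using *[of u v] assms by simp
  next
    case False
    then show ?thesis using *[of v u] assms by (simp add: dist_commute)
  qed
qed

text \<open>The condition on \<open>r\<close> puts \<open>z\<close> into the punctured disc around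
  \<open>r\<close> whose radius is the distance to the nearest other point of \<open>R\<close>. It
  survives passing to subsets of \<open>R\<close>, so \<open>C\<close> bounds how many such discs of
  any configuration can meet in one point.\<close>

definition overlap_bound :: "nat \<Rightarrow> bool" where
  "overlap_bound C \<longleftrightarrow> (\<forall>R (z::complex).
     (\<forall>r\<in>R. z \<noteq> r \<and> (\<forall>s\<in>R. s \<noteq> r \<longrightarrow> dist z r < dist r s)) \<longrightarrow> finite R \<and> card R \<le> C)"

text \<open>Seen from \<open>z\<close>, two points of \<open>R\<close> lie in directions at distance
  at least 1; otherwise \<open>dist r s\<close> would be below the larger of \<open>dist z r\<close>
  and \<open>dist z s\<close>. Choosing a net point within 1/2 of each direction is therefore
  injective.\<close>

lemma overlap_bound_exists: "\<exists>C. overlap_bound C"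
proof -
  obtain F :: "complex set" where F: "finite F"
    "\<And>z. z \<noteq> 0 \<Longrightarrow> \<exists>f\<in>F. dist f (sgn z) < 1/2"
    by (rule finite_net_unit_circle[of "1/2"]) auto
  have "finite R \<and> card R \<le> card F"
    if R: "\<forall>r\<in>R. z \<noteq> r \<and> (\<forall>s\<in>R. s \<noteq> r \<longrightarrow> dist z r < dist r s)" for R and z :: complex
  proof -
    have "\<exists>f\<in>F. dist f (sgn (r - z)) < 1/2" if "r \<in> R" for r using R F(2)[of "r - z"] that by auto
    then obtain h where h: "\<And>r. r \<in> R \<Longrightarrow> h r \<in> F \<and> dist (h r) (sgn (r - z)) < 1/2" by metis
    have inj: "inj_on h R"
    proof (rule inj_onI, rule ccontr)
      fix r s assume rs: "r \<in> R" "s \<in> R" "h r = h s" "r \<noteq> s"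
      have "dist (sgn (r - z)) (sgn (s - z)) < 1"
        using h[OF rs(1)] h[OF rs(2)] rs(3) dist_triangle_half_r[of "h r" "sgn (r - z)" 1 "sgn (s - z)"]
        by simp
      moreover have "r - z \<noteq> 0" "s - z \<noteq> 0" using R rs by auto
      ultimately have "dist (r - z) (s - z) < max (norm (r - z)) (norm (s - z))"
        by (intro dist_less_max_norm)
      then have "dist r s < max (dist z r) (dist z s)" by (simp add: dist_norm norm_minus_commute)
      moreover have "dist z r < dist r s" "dist z s < dist r s" using R rs by (auto simp: dist_commute)
      ultimately show False by simp
    qed
    have "h ` R \<subseteq> F" using h by auto
    then show ?thesis using inj F(1) by (metis card_inj_on_le inj_on_finite)
  qed
  then show ?thesis unfolding overlap_bound_def by blast
qed

lemma nearest_neighbour: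
  fixes R :: "'a::metric_space set"
  assumes "finite R" "card R \<ge> 2"
  obtains nn where "\<And>r. r \<in> R \<Longrightarrow> nn r \<in> R" "\<And>r. r \<in> R \<Longrightarrow> nn r \<noteq> r"
    "\<And>r s. r \<in> R \<Longrightarrow> s \<in> R \<Longrightarrow> s \<noteq> r \<Longrightarrow> dist r (nn r) \<le> dist r s"
proof -
  define nn where "nn r = arg_min_on (dist r) (R - {r})" for r
  have ne: "R - {r} \<noteq> {}" for r using assms(2) card_mono[of "{r}" R] by auto
  have mem: "nn r \<in> R - {r}" for r
    unfolding nn_def using assms(1) ne by (intro arg_min_if_finite(1)) auto
  show thesis
  proof (rule that[of nn])
    show "nn r \<in> R" "nn r \<noteq> r" for r using mem by auto
    show "dist r (nn r) \<le> dist r s" if "s \<in> R" "s \<noteq> r" for r s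
      unfolding nn_def using assms(1) ne that by (intro arg_min_least) auto
  qed
qed

text \<open>Double counting: on the fibre of \<open>\<Phi>\<close> over \<open>s\<close> the centres
  \<open>g i\<close> are distinct and their punctured nearest-neighbour discs share the point
  \<open>\<sigma> s\<close>, so the fibre has at most \<open>C\<close> elements. The map
  \<open>\<sigma>\<close> extracts the slope from the counted object.\<close>

lemma card_le_mult_if_near:
  fixes g :: "'i \<Rightarrow> complex"
  assumes C: "overlap_bound C"
    and S: "finite S" "\<Phi> ` I \<subseteq> S" and g: "g ` I \<subseteq> R"
    and inj: "\<And>i j. i \<in> I \<Longrightarrow> j \<in> I \<Longrightarrow> \<Phi> i = \<Phi> j \<Longrightarrow> g i = g j \<Longrightarrow> i = j"
    and ne: "\<And>i. i \<in> I \<Longrightarrow> \<sigma> (\<Phi> i) \<noteq> g i"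
    and near: "\<And>i s. i \<in> I \<Longrightarrow> s \<in> R \<Longrightarrow> s \<noteq> g i \<Longrightarrow> dist (\<sigma> (\<Phi> i)) (g i) < dist (g i) s"
  shows "card I \<le> C * card S"
proof -
  let ?fib = "\<lambda>s. {i\<in>I. \<Phi> i = s}"
  have fib: "card (?fib s) \<le> C" for s
  proof -
    have "inj_on g (?fib s)" by (auto intro!: inj_onI inj)
    moreover have "finite (g ` ?fib s) \<and> card (g ` ?fib s) \<le> C"
    proof (rule C[unfolded overlap_bound_def, rule_format])
      fix r assume "r \<in> g ` ?fib s"
      then obtain i where i: "i \<in> I" "\<Phi> i = s" "r = g i" by auto
      show "\<sigma> s \<noteq> r \<and> (\<forall>t\<in>g ` ?fib s. t \<noteq> r \<longrightarrow> dist (\<sigma> s) r < dist r t)"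
        using ne[OF i(1)] near[OF i(1)] g i by auto
    qed
    ultimately show ?thesis by (simp add: card_image)
  qed
  have "I = (\<Union>s\<in>S. ?fib s)" using S by auto
  then have "card I \<le> (\<Sum>s\<in>S. card (?fib s))" using card_UN_le[OF S(1), of ?fib] by simp
  also have "\<dots> \<le> C * card S" using sum_bounded_above[of S "\<lambda>s. card (?fib s)" C] fib by (simp add: mult.commute)
  finally show ?thesis .
qed

section \<open>Sectors\<close>

text \<open>The angular sector of half-opening arctan \<delta> around the positive real axis,
  written with linear inequalities so that closure under addition is immediate.\<close>

definition sector :: "real \<Rightarrow> complex set" where
  "sector \<delta> = {z. 0 < Re z \<and> \<bar>Im z\<bar> \<le> \<delta> * Re z}"

lemma sector_nonzero: "z \<in> sector \<delta> \<Longrightarrow> z \<noteq> 0"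
  by (auto simp: sector_def)

lemma sector_mono: "\<delta> \<le> \<epsilon> \<Longrightarrow> sector \<delta> \<subseteq> sector \<epsilon>"
  unfolding sector_def by (auto intro: order_trans[OF _ mult_right_mono])

lemma sector_add: "x \<in> sector \<delta> \<Longrightarrow> y \<in> sector \<delta> \<Longrightarrow> x + y \<in> sector \<delta>"
  by (auto simp: sector_def algebra_simps)

text \<open>Arguments add: the tangent grows to at most 2\<delta>/(1 - \<delta>^2), which is at most
  4\<delta> for \<delta> \<le> 1/2.\<close>

lemma sector_mult:
  assumes x: "x \<in> sector \<delta>" and y: "y \<in> sector \<delta>" and \<delta>: "\<delta> \<le> 1/2"
  shows "x * y \<in> sector (4 * \<delta>)"
proof -
  have p: "0 < Re x" "0 < Re y" and i: "\<bar>Im x\<bar> \<le> \<delta> * Re x" "\<bar>Im y\<bar> \<le> \<delta> * Re y"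
    using x y by (auto simp: sector_def)
  have "0 \<le> \<delta> * Re x" using i(1) by linarith
  then have \<delta>0: "0 \<le> \<delta>" using p(1) by (simp add: zero_le_mult_iff)
  have pp: "0 < Re x * Re y" using p by simp
  have "\<bar>Im x * Im y\<bar> \<le> (\<delta> * Re x) * (\<delta> * Re y)"
    unfolding abs_mult using i p \<delta>0 by (intro mult_mono) auto
  also have "\<dots> = (\<delta> * \<delta>) * (Re x * Re y)" by (simp add: algebra_simps)
  also have "\<dots> \<le> (1/2 * (1/2)) * (Re x * Re y)"
    using \<delta> \<delta>0 pp by (intro mult_right_mono mult_mono) auto
  finally have re: "Re (x * y) \<ge> 3/4 * (Re x * Re y)" by simp
  have a: "\<bar>Re x * Im y\<bar> \<le> \<delta> * (Re x * Re y)"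
    using mult_left_mono[OF i(2), of "Re x"] p by (simp add: abs_mult algebra_simps)
  have b: "\<bar>Im x * Re y\<bar> \<le> \<delta> * (Re x * Re y)"
    using mult_right_mono[OF i(1), of "Re y"] p by (simp add: abs_mult algebra_simps)
  have "\<bar>Im (x * y)\<bar> \<le> 2 * (\<delta> * (Re x * Re y))" using a b by simp
  also have "\<dots> \<le> 4 * \<delta> * (3/4 * (Re x * Re y))" using \<delta>0 pp by simp
  also have "\<dots> \<le> 4 * \<delta> * Re (x * y)" using re \<delta>0 by (intro mult_left_mono) auto
  finally show ?thesis using re pp by (simp add: sector_def)
qed

text \<open>The opening angle of \<open>sector 1\<close> is a right angle, so \<open>p\<close> and
  \<open>q\<close> have nonnegative inner product.\<close>

lemma norm_less_norm_add_sector: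
  assumes p: "p \<in> sector 1" and q: "q \<in> sector 1"
  shows "norm q < norm (p + q)"
proof -
  have "\<bar>Im p * Im q\<bar> \<le> Re p * Re q"
    unfolding abs_mult using p q by (intro mult_mono) (auto simp: sector_def)
  then have "0 \<le> Re p * Re q + Im p * Im q" by (simp add: abs_le_iff)
  moreover have "(norm p)\<^sup>2 > 0" using sector_nonzero[OF p] by simp
  ultimately have "0 < (norm p)\<^sup>2 + 2 * (Re p * Re q + Im p * Im q)" by (intro add_pos_nonneg) auto
  moreover have "(norm (p + q))\<^sup>2 = (norm q)\<^sup>2 + ((norm p)\<^sup>2 + 2 * (Re p * Re q + Im p * Im q))"
    by (simp add: cmod_power2 power2_sum)
  ultimately have "(norm q)\<^sup>2 < (norm (p + q))\<^sup>2" by (simp only: less_add_same_cancel1)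
  then show ?thesis by (rule power2_less_imp_less) simp
qed

text \<open>Here \<open>z\<close> is the slope of (p, r p) + (q, s q). It satisfies z - r = (s - r)
  q/(p + q), and q/(p + q) has norm strictly between 0 and 1. This replaces the betweenness of
  slopes over the reals.\<close>

lemma slope_of_sum:
  fixes r s :: complex
  assumes p: "p \<in> sector 1" and q: "q \<in> sector 1" and rs: "r \<noteq> s"
  defines "z \<equiv> (r * p + s * q) / (p + q)"
  shows "z \<noteq> r" and "dist z r < dist r s"
proof -
  have q0: "q \<noteq> 0" and pq: "p + q \<noteq> 0" using sector_nonzero[OF q] sector_nonzero[OF sector_add[OF p q]] .
  have *: "z - r = (s - r) * (q / (p + q))" using pq by (simp add: z_def field_simps)
  have "(s - r) * (q / (p + q)) \<noteq> 0" using q0 pq rs by simp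
  then show "z \<noteq> r" using * by auto
  have "norm (q / (p + q)) < 1" using norm_less_norm_add_sector[OF p q] pq by (simp add: norm_divide)
  then have "norm (s - r) * norm (q / (p + q)) < norm (s - r) * 1"
    using rs by (intro mult_strict_left_mono) auto
  then show "dist z r < dist r s" unfolding dist_norm * norm_mult by (simp add: norm_minus_commute)
qed

text \<open>Division by \<open>f\<close> rotates \<open>sgn z\<close> to within \<delta>/2 of 1,
  where the real part exceeds 1/2 and the imaginary part is below \<delta>/2 in absolute
  value.\<close>

lemma sgn_near_sector:
  assumes f: "norm f = 1" and z: "z \<noteq> 0" and "dist f (sgn z) < \<delta> / 2" and \<delta>: "0 < \<delta>" "\<delta> \<le> 1"
  shows "z / f \<in> sector \<delta>"
proof -
  define w where "w = sgn z / f"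
  have f0: "f \<noteq> 0" using f by auto
  have "sgn z - f = f * (w - 1)" using f0 by (simp add: w_def field_simps)
  then have "norm (w - 1) = norm (sgn z - f)" using f by (simp add: norm_mult)
  then have w: "norm (w - 1) < \<delta> / 2" using assms(3) by (simp add: dist_norm norm_minus_commute)
  have re: "Re w > 1/2" using abs_Re_le_cmod[of "w - 1"] w \<delta> by simp
  have "\<bar>Im w\<bar> \<le> \<delta> * (1/2)" using abs_Im_le_cmod[of "w - 1"] w by simp
  also have "\<dots> \<le> \<delta> * Re w" using re \<delta> by (intro mult_left_mono) auto
  finally have im: "\<bar>Im w\<bar> \<le> \<delta> * Re w" .
  have zf: "z / f = of_real (norm z) * w" using z by (simp add: w_def sgn_eq)
  have "norm z * \<bar>Im w\<bar> \<le> norm z * (\<delta> * Re w)" using im by (intro mult_left_mono) auto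
  then show ?thesis using re z by (simp add: zf sector_def abs_mult mult.left_commute)
qed

section \<open>Iterated sum and product sets\<close>

lemma finite_sumset: "finite X \<Longrightarrow> finite (sumset m X)"
proof (induction m)
  case (Suc m)
  have "sumset (Suc m) X = (\<lambda>(x, y). x + y) ` (X \<times> sumset m X)" by auto
  then show ?case using Suc by simp
qed simp

lemma finite_prodset: "finite X \<Longrightarrow> finite (prodset m X)"
proof (induction m)
  case (Suc m)
  have "prodset (Suc m) X = (\<lambda>(x, y). x * y) ` (X \<times> prodset m X)" by auto
  then show ?case using Suc by simp
qed simp

lemma sumset_mono: "X \<subseteq> Y \<Longrightarrow> sumset m X \<subseteq> sumset m Y"
  by (induction m) (simp, fastforce)

lemma prodset_mono: "X \<subseteq> Y \<Longrightarrow> prodset m X \<subseteq> prodset m Y"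
  by (induction m) (simp, fastforce)

lemma sumset_nonempty: "X \<noteq> {} \<Longrightarrow> sumset m X \<noteq> {}"
  by (induction m) auto

lemma prodset_nonempty: "X \<noteq> {} \<Longrightarrow> prodset m X \<noteq> {}"
  by (induction m) auto

lemma sumset_add: "x \<in> sumset m X \<Longrightarrow> y \<in> sumset n X \<Longrightarrow> x + y \<in> sumset (m + n) X"
proof (induction m arbitrary: x)
  case (Suc m)
  then obtain a b where "x = a + b" "a \<in> X" "b \<in> sumset m X" by auto
  then have "x + y = a + (b + y)" "b + y \<in> sumset (m + n) X" using Suc by (simp_all add: add.assoc)
  then show ?case using \<open>a \<in> X\<close> unfolding add_Suc sumset.simps by blast
qed simp

lemma sumset_image_mult: "sumset m ((*) u ` X) = (*) u ` sumset m X"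
proof (induction m)
  case (Suc m)
  show ?case
    by (auto simp: Suc image_iff distrib_left) (metis distrib_left)+
qed simp

lemma prodset_image_mult: "prodset m ((*) u ` X) = (*) (u ^ m) ` prodset m X"
proof (induction m)
  case (Suc m)
  have "prodset (Suc m) ((*) u ` X) = {u * x * (u ^ m * y) | x y. x \<in> X \<and> y \<in> prodset m X}"
    using Suc by auto
  also have "\<dots> = {u ^ Suc m * (x * y) | x y. x \<in> X \<and> y \<in> prodset m X}"
    by (simp add: ac_simps)
  also have "\<dots> = (*) (u ^ Suc m) ` prodset (Suc m) X" by auto
  finally show ?case .
qed simp

lemma sumset_prodset_mult:
  assumes "a \<in> X" "b \<in> sumset m (prodset k X)"
  shows "b * a \<in> sumset m (prodset (Suc k) X)"
proof -
  have "(*) a ` prodset k X \<subseteq> prodset (Suc k) X" using assms by auto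
  then have "sumset m ((*) a ` prodset k X) \<subseteq> sumset m (prodset (Suc k) X)" by (rule sumset_mono)
  then have "a * b \<in> sumset m (prodset (Suc k) X)"
    using assms(2) unfolding sumset_image_mult by blast
  then show ?thesis by (simp only: mult.commute)
qed

text \<open>The index starts at one because the empty sum 0 lies in no sector.\<close>

lemma sumset_sector: "X \<subseteq> sector \<delta> \<Longrightarrow> sumset (Suc m) X \<subseteq> sector \<delta>"
proof (induction m)
  case (Suc m)
  have "sumset (Suc (Suc m)) X = {x + y | x y. x \<in> X \<and> y \<in> sumset (Suc m) X}" by simp
  then show ?case using Suc by (auto intro!: sector_add simp del: sumset.simps)
qed auto

text \<open>Each factor at most quadruples the opening; the bound on 4^m \<delta> keeps every
  intermediate sector within the range of \<open>sector_mult\<close>.\<close>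

lemma prodset_sector:
  assumes "A \<subseteq> sector \<delta>" "0 \<le> \<delta>" "4 ^ m * \<delta> \<le> 1"
  shows "prodset m A \<subseteq> sector (4 ^ m * \<delta>)"
  using assms(3)
proof (induction m)
  case 0
  then show ?case using assms(2) by (simp add: sector_def)
next
  case (Suc m)
  have le: "4 ^ m * \<delta> \<le> 1/2" using Suc.prems by simp
  have "1 * \<delta> \<le> 4 ^ m * \<delta>" using assms(2) by (intro mult_right_mono) auto
  then have "A \<subseteq> sector (4 ^ m * \<delta>)" using assms(1) sector_mono[of \<delta> "4 ^ m * \<delta>"] by auto
  moreover have "prodset m A \<subseteq> sector (4 ^ m * \<delta>)" using Suc.IH le by simp
  ultimately have "x * y \<in> sector (4 * (4 ^ m * \<delta>))" if "x \<in> A" "y \<in> prodset m A" for x y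
    using that le by (intro sector_mult) auto
  then show ?case by (auto simp: mult.assoc)
qed

section \<open>Ratios of sums\<close>

text \<open>These are the slopes of the points (c + d, a + b) of (A + A)^2; the denominators are
  nonzero for \<open>A\<close> in a sector.\<close>

definition ratios :: "complex set \<Rightarrow> complex set" where
  "ratios A = {(a + b) / (c + d) | a b c d. a \<in> A \<and> b \<in> A \<and> c \<in> A \<and> d \<in> A}"

lemma finite_ratios: "finite A \<Longrightarrow> finite (ratios A)"
proof -
  assume "finite A"
  moreover have "ratios A = (\<lambda>(a, b, c, d). (a + b) / (c + d)) ` (A \<times> A \<times> A \<times> A)"
    by (force simp: ratios_def image_def)
  ultimately show ?thesis by simp
qed

lemma ex_two:
  assumes "card A \<ge> 2"
  obtains a b where "a \<in> A" "b \<in> A" "a \<noteq> b"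
proof -
  have "finite A" "\<not> card A \<le> Suc 0" using assms by (auto intro: card_ge_0_finite)
  then show thesis using that by (auto simp: card_le_Suc0_iff_eq)
qed

lemma two_le_card:
  assumes "finite A" "a \<in> A" "b \<in> A" "a \<noteq> b"
  shows "card A \<ge> 2"
  using assms card_mono[of A "{a, b}"] by simp

lemma card_ratios_ge_2:
  assumes "finite A" "card A \<ge> 2" "A \<subseteq> sector \<delta>"
  shows "card (ratios A) \<ge> 2"
proof -
  obtain a b where ab: "a \<in> A" "b \<in> A" "a \<noteq> b" using ex_two[OF assms(2)] .
  have "(a + a) / (a + a) \<in> ratios A" "(a + b) / (a + a) \<in> ratios A"
    using ab unfolding ratios_def by blast+
  moreover have "a \<noteq> 0" using ab assms sector_nonzero by blast
  then have "(a + a) / (a + a) \<noteq> (a + b) / (a + a)" using ab by (simp add: field_simps)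
  ultimately show ?thesis by (intro two_le_card finite_ratios assms(1))
qed

text \<open>Each point (a, b) of A x A, of slope r, is added to one fixed point of A x A on the line
  of slope \<open>nn r\<close>. The slope of the sum is a ratio, lies in the disc of r, and
  determines (a, b) once r is known.\<close>

lemma card_ratios:
  assumes C: "overlap_bound C" and A: "finite A" "card A \<ge> 2" "A \<subseteq> sector 1"
  shows "(card A)\<^sup>2 \<le> C * card (ratios A)"
proof -
  define R where "R = (\<lambda>(a, b). b / a) ` (A \<times> A)"
  have nz: "a \<noteq> 0" if "a \<in> A" for a using that A(3) sector_nonzero by blast
  have R: "b / a \<in> R" if "a \<in> A" "b \<in> A" for a b using that by (auto simp: R_def)
  have fR: "finite R" using A by (simp add: R_def)
  have "card R \<ge> 2"
  proof -
    obtain a b where ab: "a \<in> A" "b \<in> A" "a \<noteq> b" using ex_two[OF A(2)] .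
    then have "a / a \<noteq> b / a" using nz by (simp add: field_simps)
    then show ?thesis by (intro two_le_card[OF fR R[OF ab(1,1)] R[OF ab(1,2)]])
  qed
  from nearest_neighbour[OF fR this] obtain nn
    where nn: "\<And>r. r \<in> R \<Longrightarrow> nn r \<in> R" "\<And>r. r \<in> R \<Longrightarrow> nn r \<noteq> r"
      "\<And>r s. r \<in> R \<Longrightarrow> s \<in> R \<Longrightarrow> s \<noteq> r \<Longrightarrow> dist r (nn r) \<le> dist r s"
    by blast
  \<comment> \<open>\<open>q r\<close> is the first coordinate of a chosen point of A x A on the
    line of slope \<open>r\<close>.\<close>
  have "\<forall>r\<in>R. \<exists>q. q \<in> A \<and> r * q \<in> A" using nz by (auto simp: R_def)
  then obtain q where q: "\<And>r. r \<in> R \<Longrightarrow> q r \<in> A" "\<And>r. r \<in> R \<Longrightarrow> r * q r \<in> A" by metis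
  define z where "z = (\<lambda>(a, b). (b + nn (b/a) * q (nn (b/a))) / (a + q (nn (b/a))))"
  have slope: "z (a, b) \<noteq> b / a \<and> dist (z (a, b)) (b / a) < dist (b / a) (nn (b / a))"
    if "a \<in> A" "b \<in> A" for a b
  proof -
    define r where "r = b / a"
    have "r \<in> R" using R that by (simp add: r_def)
    then have "q (nn r) \<in> sector 1" "r \<noteq> nn r" using q(1)[of "nn r"] nn(1,2)[of r] A(3) by auto
    moreover have "a \<in> sector 1" using that A(3) by auto
    moreover have "z (a, b) = (r * a + nn r * q (nn r)) / (a + q (nn r))"
      using nz that by (simp add: z_def r_def)
    ultimately show ?thesis
      using slope_of_sum[of a "q (nn r)" r "nn r"] unfolding r_def[symmetric] by simp
  qed
  have "card (A \<times> A) \<le> C * card (ratios A)"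
  proof (rule card_le_mult_if_near[OF C finite_ratios[OF A(1)],
        where \<Phi> = z and \<sigma> = id and g = "\<lambda>(a, b). b / a" and R = R])
    show "z ` (A \<times> A) \<subseteq> ratios A"
    proof
      fix w assume "w \<in> z ` (A \<times> A)"
      then obtain a b where ab: "a \<in> A" "b \<in> A" "w = z (a, b)" by auto
      define s where "s = nn (b / a)"
      have "s \<in> R" using nn(1) R ab by (simp add: s_def)
      then have "s * q s \<in> A" "q s \<in> A" using q by auto
      moreover have "w = (b + s * q s) / (a + q s)" by (simp add: ab(3) z_def s_def)
      ultimately show "w \<in> ratios A" unfolding ratios_def using ab by blast
    qed
    show "(\<lambda>(a, b). b / a) ` (A \<times> A) \<subseteq> R" by (simp add: R_def)
  next
    fix i j assume ij: "i \<in> A \<times> A" "j \<in> A \<times> A" "z i = z j"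
      "(case i of (a, b) \<Rightarrow> b / a) = (case j of (a, b) \<Rightarrow> b / a)"
    obtain a b a' b' where i: "i = (a, b)" and j: "j = (a', b')" by (cases i, cases j)
    define r s p where "r = b / a" and "s = nn r" and "p = q s"
    have mem: "a \<in> A" "b \<in> A" "a' \<in> A" "b' \<in> A" using ij i j by auto
    have r: "r \<in> R" "r = b' / a'" using R mem ij i j by (auto simp: r_def)
    have b: "b = r * a" "b' = r * a'" using nz mem by (simp add: r_def) (simp add: r(2) nz mem)
    have p: "p \<in> A" "s \<noteq> r" using q nn r by (auto simp: p_def s_def)
    have ap: "a + p \<noteq> 0" "a' + p \<noteq> 0" 
      using sector_nonzero[OF sector_add] mem p A(3) by blast+
    have "z i = (b + s * p) / (a + p)" by (simp add: i z_def r_def s_def p_def)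
    moreover have "z j = (b' + s * p) / (a' + p)" by (simp add: j z_def r(2) s_def p_def)
    ultimately have "(b + s * p) / (a + p) = (b' + s * p) / (a' + p)" using ij(3) by metis
    then have "(b + s * p) * (a' + p) = (b' + s * p) * (a + p)" using frac_eq_eq[OF ap] by blast
    then have eq: "(r * a + s * p) * (a' + p) = (r * a' + s * p) * (a + p)" by (simp only: b)
    \<comment> \<open>For fixed r the map a -> (r a + s p)/(a + p) is a Moebius transformation of
      nonzero determinant (r - s) p, hence injective.\<close>
    have "(r - s) * p * (a - a') = (r * a + s * p) * (a' + p) - (r * a' + s * p) * (a + p)"
      by (simp add: algebra_simps)
    also have "\<dots> = 0" using eq by simp
    finally have "(r - s) * p * (a - a') = 0" .
    then have "a = a'" using p nz[OF p(1)] by simp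
    then show "i = j" unfolding i j by (simp only: b)
  next
    fix i assume "i \<in> A \<times> A"
    then show "id (z i) \<noteq> (case i of (a, b) \<Rightarrow> b / a)" using slope by auto
  next
    fix i s assume "i \<in> A \<times> A" "s \<in> R" "s \<noteq> (case i of (a, b) \<Rightarrow> b / a)"
    moreover from this obtain a b where "i = (a, b)" "a \<in> A" "b \<in> A" by auto
    ultimately show "dist (id (z i)) (case i of (a, b) \<Rightarrow> b / a) < dist (case i of (a, b) \<Rightarrow> b / a) s"
      using slope[of a b] nn(3)[of "b / a" s] R by fastforce
  qed
  then show ?thesis by (simp add: card_cartesian_product power2_eq_square)
qed

text \<open>Choose a vector v_r = (q r, r * q r) of (A + A)^2 for every slope r, and count the
  points x v_r + y v_s with s = \<open>nn r\<close> and x, y in \<open>B\<close>. Both coordinates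
  lie in \<open>D\<close>, the slope lies in the disc of r, and r and the point determine x and y
  because v_r and v_s are linearly independent. Hypothesis \<open>BA\<close> makes
  \<open>slope_of_sum\<close> applicable.\<close>

lemma card_dilates:
  assumes C: "overlap_bound C" and A: "finite A" "card A \<ge> 2" "A \<subseteq> sector \<delta>"
    and BA: "\<And>x a b. x \<in> B \<Longrightarrow> a \<in> A \<Longrightarrow> b \<in> A \<Longrightarrow> x * (a + b) \<in> sector 1"
    and D: "finite D" "\<And>x y a b c d. x \<in> B \<Longrightarrow> y \<in> B \<Longrightarrow> a \<in> A \<Longrightarrow> b \<in> A \<Longrightarrow> c \<in> A \<Longrightarrow> d \<in> A
      \<Longrightarrow> x * (a + b) + y * (c + d) \<in> D"
  shows "card (ratios A) * (card B)\<^sup>2 \<le> C * (card D)\<^sup>2"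
proof -
  define R where "R = ratios A"
  define T where "T = {a + b | a b. a \<in> A \<and> b \<in> A}"
  have Tcases: "\<exists>a\<in>A. \<exists>b\<in>A. t = a + b" if "t \<in> T" for t
    using that unfolding T_def by blast
  have T: "x * t \<in> sector 1" if "x \<in> B" "t \<in> T" for x t
    using Tcases[OF that(2)] BA[OF that(1)] by auto
  have TD: "x * t + y * u \<in> D" if xy: "x \<in> B" "y \<in> B" and tu: "t \<in> T" "u \<in> T" for x y t u
  proof -
    obtain a b c d where "a \<in> A" "b \<in> A" "c \<in> A" "d \<in> A" and t: "t = a + b" and u: "u = c + d"
      using Tcases[OF tu(1)] Tcases[OF tu(2)] by auto
    then show ?thesis unfolding t u by (intro D(2) xy)
  qed
  have nz: "t \<noteq> 0" if tT: "t \<in> T" for t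
  proof -
    obtain a b where "a \<in> A" "b \<in> A" "t = a + b" using Tcases[OF tT] by auto
    then show ?thesis using sector_nonzero[OF sector_add, of a \<delta> b] A(3) by auto
  qed
  have fR: "finite R" using A by (simp add: R_def finite_ratios)
  have "card R \<ge> 2" unfolding R_def by (rule card_ratios_ge_2[OF A])
  from nearest_neighbour[OF fR this] obtain nn
    where nn: "\<And>r. r \<in> R \<Longrightarrow> nn r \<in> R" "\<And>r. r \<in> R \<Longrightarrow> nn r \<noteq> r"
      "\<And>r s. r \<in> R \<Longrightarrow> s \<in> R \<Longrightarrow> s \<noteq> r \<Longrightarrow> dist r (nn r) \<le> dist r s"
    by blast
  have "\<exists>q. q \<in> T \<and> r * q \<in> T" if rR: "r \<in> R" for r
  proof -
    obtain a b c d where "a \<in> A" "b \<in> A" "c \<in> A" "d \<in> A" and r: "r = (a + b) / (c + d)"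
      using rR unfolding R_def ratios_def by blast
    then have tu: "c + d \<in> T" "a + b \<in> T" unfolding T_def by blast+
    then show ?thesis using nz[OF tu(1)] by (intro exI[of _ "c + d"]) (simp add: r)
  qed
  then obtain q where q: "\<And>r. r \<in> R \<Longrightarrow> q r \<in> T" "\<And>r. r \<in> R \<Longrightarrow> r * q r \<in> T" by metis
  define P where "P = (\<lambda>(r, x, y). (x * q r + y * q (nn r), r * (x * q r) + nn r * (y * q (nn r))))"
  define \<sigma> where "\<sigma> = (\<lambda>(u, v). v / u :: complex)"
  have slope: "\<sigma> (P (r, x, y)) \<noteq> r \<and> dist (\<sigma> (P (r, x, y))) r < dist r (nn r)"
    if "r \<in> R" "x \<in> B" "y \<in> B" for r x y
  proof -
    have "x * q r \<in> sector 1" "y * q (nn r) \<in> sector 1" "r \<noteq> nn r"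
      using T[OF that(2) q(1)[OF that(1)]] T[OF that(3) q(1)[OF nn(1)[OF that(1)]]] nn(2)[OF that(1)]
      by auto
    from slope_of_sum[OF this] show ?thesis by (simp add: \<sigma>_def P_def)
  qed
  have "card (R \<times> B \<times> B) \<le> C * card (D \<times> D)"
  proof (rule card_le_mult_if_near[OF C, where \<Phi> = P and \<sigma> = \<sigma> and g = fst and R = R])
    show "finite (D \<times> D)" using D by simp
    show "P ` (R \<times> B \<times> B) \<subseteq> D \<times> D"
    proof
      fix w assume "w \<in> P ` (R \<times> B \<times> B)"
      then obtain r x y where *: "r \<in> R" "x \<in> B" "y \<in> B" "w = P (r, x, y)" by auto
      have "x * q r + y * q (nn r) \<in> D" using * q nn by (intro TD) auto
      moreover have "x * (r * q r) + y * (nn r * q (nn r)) \<in> D" using * q nn by (intro TD) auto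
      ultimately show "w \<in> D \<times> D" by (simp add: *(4) P_def mult.left_commute)
    qed
    show "fst ` (R \<times> B \<times> B) \<subseteq> R" by auto
  next
    fix i j assume ij: "i \<in> R \<times> B \<times> B" "j \<in> R \<times> B \<times> B" "P i = P j" "fst i = fst j"
    obtain r x y x' y' where i: "i = (r, x, y)" and j: "j = (r, x', y')"
      using ij(4) by (cases i, cases j) auto
    define s u v where "s = nn r" and "u = q r" and "v = q s"
    have r: "r \<in> R" using ij i by auto
    have uv: "u \<noteq> 0" "v \<noteq> 0" "s \<noteq> r" using r nn q nz by (auto simp: s_def u_def v_def)
    have 1: "x * u + y * v = x' * u + y' * v" and 2: "r * (x * u) + s * (y * v) = r * (x' * u) + s * (y' * v)"
      using ij(3) by (auto simp: i j P_def s_def u_def v_def)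
    \<comment> \<open>Subtracting the second coordinate from s times the first eliminates y.\<close>
    have "(s - r) * (u * (x - x')) = s * (x * u + y * v - (x' * u + y' * v))
        - (r * (x * u) + s * (y * v) - (r * (x' * u) + s * (y' * v)))"
      by (simp add: algebra_simps)
    also have "\<dots> = 0" using 1 2 by simp
    finally have "x = x'" using uv by simp
    then show "i = j" using 1 uv i j by simp
  next
    fix i assume "i \<in> R \<times> B \<times> B"
    then show "\<sigma> (P i) \<noteq> fst i" using slope by auto
  next
    fix i s assume "i \<in> R \<times> B \<times> B" "s \<in> R" "s \<noteq> fst i"
    moreover from this obtain r x y where "i = (r, x, y)" "r \<in> R" "x \<in> B" "y \<in> B" by auto
    ultimately show "dist (\<sigma> (P i)) (fst i) < dist (fst i) s"
      using slope[of r x y] nn(3)[of r s] by simp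
  qed
  then show ?thesis by (simp add: card_cartesian_product power2_eq_square R_def)
qed

section \<open>Growth of iterated sum-product sets\<close>

text \<open>Induction on \<open>j\<close>. Combining |A|^2 \<le> C |R| with |R| |B|^2 \<le> C |D|^2
  eliminates the number |R| of ratios and leaves a comparison of squares, whence |A| |B| \<le> C
  |D|.\<close>

lemma card_sumset_prodset_sector:
  assumes C: "overlap_bound C" and A: "finite A" "card A \<ge> 2" "A \<subseteq> sector \<delta>"
    and \<delta>: "0 \<le> \<delta>" "4 ^ Suc j * \<delta> \<le> 1"
  shows "card A ^ Suc j \<le> C ^ j * card (sumset (4 ^ j) (prodset (Suc j) A))"
  using \<delta>(2)
proof (induction j)
  case 0
  have "{x + y |x y. x \<in> {x * y |x y. x \<in> A \<and> y = 1} \<and> y = 0} = A" by auto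
  then show ?case by simp
next
  case (Suc j)
  define B where "B = sumset (4 ^ j) (prodset (Suc j) A)"
  define D where "D = sumset (4 ^ Suc j) (prodset (Suc (Suc j)) A)"
  \<comment> \<open>Products of \<open>Suc j\<close> elements of \<open>A\<close> stay in
    \<open>sector \<eta>\<close>; multiplying by an element of A + A leads to
    \<open>sector (4 * \<eta>)\<close>, and the hypothesis on \<delta> says exactly 4 \<eta> \<le>
    1.\<close>
  define \<eta> where "\<eta> = 4 ^ Suc j * \<delta>"
  have \<eta>: "\<eta> \<le> 1/4" "\<eta> \<le> 1" "\<eta> \<le> 1/2" "4 * \<eta> \<le> 1" using Suc.prems by (auto simp: \<eta>_def)
  have "1 * \<delta> \<le> \<eta>" unfolding \<eta>_def using \<delta>(1) by (intro mult_right_mono one_le_power) auto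
  then have A\<eta>: "A \<subseteq> sector \<eta>" and A1: "A \<subseteq> sector 1"
    using A(3) \<eta> sector_mono[of \<delta> \<eta>] sector_mono[of \<delta> 1] by auto
  have "prodset (Suc j) A \<subseteq> sector \<eta>"
    unfolding \<eta>_def using A(3) \<delta>(1) \<eta>(2) by (intro prodset_sector) (auto simp: \<eta>_def)
  then have B\<eta>: "B \<subseteq> sector \<eta>"
    unfolding B_def using sumset_sector[of _ _ "4 ^ j - 1"] by (simp del: sumset.simps prodset.simps)
  have "card (ratios A) * (card B)\<^sup>2 \<le> C * (card D)\<^sup>2"
  proof (rule card_dilates[OF C A])
    fix x a b assume "x \<in> B" "a \<in> A" "b \<in> A"
    then have "x * (a + b) \<in> sector (4 * \<eta>)" using A\<eta> B\<eta> \<eta> by (intro sector_mult sector_add) auto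
    then show "x * (a + b) \<in> sector 1" using sector_mono \<eta> by blast
  next
    show "finite D" unfolding D_def by (intro finite_sumset finite_prodset A)
  next
    fix x y a b c d assume *: "x \<in> B" "y \<in> B" "a \<in> A" "b \<in> A" "c \<in> A" "d \<in> A"
    let ?X = "prodset (Suc (Suc j)) A"
    have "x * a \<in> sumset (4 ^ j) ?X" "x * b \<in> sumset (4 ^ j) ?X"
      "y * c \<in> sumset (4 ^ j) ?X" "y * d \<in> sumset (4 ^ j) ?X"
      using * unfolding B_def by (auto intro!: sumset_prodset_mult simp del: prodset.simps)
    \<comment> \<open>Four sums of 4^j terms each are added: this is the source of the factor 4 per
      step in the number of summands.\<close>
    then have "(x * a + x * b) + (y * c + y * d) \<in> sumset ((4 ^ j + 4 ^ j) + (4 ^ j + 4 ^ j)) ?X"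
      by (intro sumset_add)
    moreover have "(4::nat) ^ j + 4 ^ j + (4 ^ j + 4 ^ j) = 4 ^ Suc j" by simp
    ultimately show "x * (a + b) + y * (c + d) \<in> D" unfolding D_def by (simp only: distrib_left)
  qed
  moreover have "(card A)\<^sup>2 \<le> C * card (ratios A)" by (rule card_ratios[OF C A(1,2) A1])
  ultimately have "(card A)\<^sup>2 * (card B)\<^sup>2 \<le> C * (C * (card D)\<^sup>2)"
    using mult_le_mono1[of "(card A)\<^sup>2" "C * card (ratios A)" "(card B)\<^sup>2"]
      mult_le_mono2[of "card (ratios A) * (card B)\<^sup>2" "C * (card D)\<^sup>2" C]
    unfolding mult.assoc by linarith
  also have "\<dots> = (C * card D)\<^sup>2" by (simp only: power_mult_distrib power2_eq_square[of C] mult.assoc)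
  finally have "(card A * card B)\<^sup>2 \<le> (C * card D)\<^sup>2" by (simp only: power_mult_distrib)
  then have AB: "card A * card B \<le> C * card D" by (rule power2_le_imp_le) simp
  have "card A ^ Suc j \<le> C ^ j * card B" unfolding B_def using \<eta>(2) by (intro Suc.IH) (simp only: \<eta>_def)
  then have "card A ^ Suc (Suc j) \<le> card A * (C ^ j * card B)"
    unfolding power_Suc[of _ "Suc j"] by (rule mult_le_mono2)
  also have "\<dots> = C ^ j * (card A * card B)" by (rule mult.left_commute)
  also have "\<dots> \<le> C ^ j * (C * card D)" using AB by (rule mult_le_mono2)
  also have "\<dots> = C ^ Suc j * card D" by (simp only: power_Suc2 mult.assoc)
  finally show ?case unfolding D_def .
qed

section \<open>From sectors to arbitrary finite sets\<close>

lemma card_sumset_prodset_rotate: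
  assumes "u \<noteq> 0"
  shows "card (sumset m (prodset k ((*) u ` A))) = card (sumset m (prodset k A))"
proof -
  have "inj_on ((*) (u ^ k)) X" for X using assms by (auto intro!: inj_onI)
  then show ?thesis by (simp add: prodset_image_mult sumset_image_mult card_image)
qed

text \<open>Pigeonhole over the directions in \<open>F\<close>. The factor 2 absorbs a possible
  element 0, since \<open>A\<close> has some nonzero element.\<close>

lemma card_le_sectors:
  assumes F: "finite F" "\<And>z. z \<noteq> 0 \<Longrightarrow> \<exists>f\<in>F. Q f z" and A: "finite A" "A - {0} \<noteq> {}"
  obtains f where "f \<in> F" "card A \<le> 2 * card F * card {a \<in> A - {0}. Q f a}"
proof -
  define n where "n f = card {a \<in> A - {0}. Q f a}" for f
  have F0: "F \<noteq> {}" using F(2) A(2) by blast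
  have "Max (n ` F) \<in> n ` F" using F0 F(1) by simp
  then obtain f where "f \<in> F" "n f = Max (n ` F)" by auto
  then have f: "f \<in> F" "\<And>g. g \<in> F \<Longrightarrow> n g \<le> n f" using F(1) by auto
  have "A - {0} = (\<Union>f\<in>F. {a \<in> A - {0}. Q f a})" using F(2) by auto
  then have "card (A - {0}) \<le> (\<Sum>f\<in>F. n f)" unfolding n_def using card_UN_le[OF F(1)] by metis
  also have "\<dots> \<le> card F * n f" using sum_bounded_above[of F n "n f"] f by simp
  finally have "card (A - {0}) \<le> card F * n f" .
  moreover have "card A \<le> Suc (card (A - {0}))"
    using card_mono[of "insert 0 (A - {0})" A] card_insert_if[of "A - {0}" 0] A(1) by auto
  moreover have "card (A - {0}) > 0" using A by (simp add: card_gt_0_iff)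
  ultimately have "card A \<le> 2 * card F * n f" by simp
  then show thesis using that f(1) by (simp add: n_def)
qed

theorem theorem5:
  fixes k :: nat
  assumes "k \<ge> 1"
  shows "\<exists>c::real. c > 0 \<and>
           (\<forall>A :: complex set. finite A \<longrightarrow>
              real (card (sumset (4 ^ (k - 1)) (prodset k A))) \<ge> c * real (card A) ^ k)"
proof -
  obtain j where k: "k = Suc j" using assms by (cases k) auto
  obtain C0 where "overlap_bound C0" using overlap_bound_exists by blast
  \<comment> \<open>Enlarging the constant makes it positive, so that its powers are at least 1 when
    a singleton is treated below.\<close>
  then have C: "overlap_bound (Suc C0)" unfolding overlap_bound_def by (meson le_SucI)
  define \<delta> :: real where "\<delta> = 1 / 4 ^ k"
  have \<delta>: "0 < \<delta>" "\<delta> \<le> 1" "4 ^ Suc j * \<delta> \<le> 1"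
    using one_le_power[of "4::real" k] by (simp_all add: \<delta>_def k)
  obtain F :: "complex set" where F: "finite F" "\<And>f. f \<in> F \<Longrightarrow> norm f = 1"
    "\<And>z. z \<noteq> 0 \<Longrightarrow> \<exists>f\<in>F. dist f (sgn z) < \<delta> / 2"
    using finite_net_unit_circle[of "\<delta> / 2"] \<delta> by auto
  define N where "N = 2 * card F"
  \<comment> \<open>The successor makes \<open>K\<close> positive, which settles A = {0} and allows
    division by \<open>K\<close>.\<close>
  define K where "K = Suc (N ^ k * Suc C0 ^ j)"
  let ?S = "\<lambda>A. card (sumset (4 ^ j) (prodset k A))"
  have main: "card A ^ k \<le> K * ?S A" if fA: "finite A" for A
  proof (cases "A = {}")
    case True
    then show ?thesis by (simp add: k)
  next
    case False
    have fin: "finite (sumset (4 ^ j) (prodset k A))" by (intro finite_sumset finite_prodset fA)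
    have pos: "1 \<le> ?S X" if "X \<noteq> {}" "finite X" for X
    proof -
      have "sumset (4 ^ j) (prodset k X) \<noteq> {}" by (intro sumset_nonempty prodset_nonempty that)
      moreover have "finite (sumset (4 ^ j) (prodset k X))" by (intro finite_sumset finite_prodset that)
      ultimately show ?thesis by (simp add: Suc_le_eq card_gt_0_iff)
    qed
    show ?thesis
    proof (cases "A - {0} = {}")
      case True
      then have "A = {0}" using False by auto
      then show ?thesis using pos[of A] by (simp add: K_def)
    next
      case nontriv: False
      obtain f where f: "f \<in> F" "card A \<le> 2 * card F * card {a \<in> A - {0}. dist f (sgn a) < \<delta> / 2}"
        using card_le_sectors[of F "\<lambda>f a. dist f (sgn a) < \<delta> / 2", OF F(1,3) fA nontriv] .
      define A1 where "A1 = {a \<in> A - {0}. dist f (sgn a) < \<delta> / 2}"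
      \<comment> \<open>The part of \<open>A\<close> in the richest direction is rotated onto the
        positive real axis; the cardinality of the sum-product set does not change.\<close>
      define A2 where "A2 = (*) (1 / f) ` A1"
      have f0: "1 / f \<noteq> 0" using F(2)[OF f(1)] by auto
      have A1: "A1 \<subseteq> A" "finite A1" using fA by (auto simp: A1_def)
      have "card A > 0" using False fA by (simp add: card_gt_0_iff)
      then have A1ne: "card A1 > 0" using f(2) unfolding A1_def by (metis gr0I mult_0_right not_le)
      have card2: "card A2 = card A1" unfolding A2_def using f0 by (auto intro!: card_image inj_onI)
      have S2: "?S A2 = ?S A1" unfolding A2_def using card_sumset_prodset_rotate[OF f0] .
      have sector2: "A2 \<subseteq> sector \<delta>"
        using sgn_near_sector[OF F(2)[OF f(1)] _ _ \<delta>(1,2)] by (auto simp: A2_def A1_def)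
      have "card A1 ^ k \<le> Suc C0 ^ j * ?S A1"
      proof (cases "card A1 \<ge> 2")
        case True
        then show ?thesis
          using card_sumset_prodset_sector[OF C _ _ sector2 _ \<delta>(3)] card2 S2 A1 \<delta> k
          by (simp add: A2_def del: sumset.simps prodset.simps power_Suc)
      next
        \<comment> \<open>A single point has no neighbouring slope, so the growth lemma does not
          apply, but both sides are trivial to compare.\<close>
        case False
        then have "card A1 = 1" using A1ne by simp
        moreover have "1 \<le> ?S A1" using pos[of A1] A1 A1ne by (simp add: card_gt_0_iff)
        moreover have "1 \<le> Suc C0 ^ j" by simp
        ultimately show ?thesis by (metis mult_le_mono power_one mult_1)
      qed
      also have "?S A1 \<le> ?S A" by (intro card_mono fin sumset_mono prodset_mono A1)
      finally have *: "card A1 ^ k \<le> Suc C0 ^ j * ?S A" by simp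
      have "card A ^ k \<le> (N * card A1) ^ k" using f(2) by (intro power_mono) (auto simp: N_def A1_def)
      also have "\<dots> = N ^ k * card A1 ^ k" by (rule power_mult_distrib)
      also have "\<dots> \<le> N ^ k * (Suc C0 ^ j * ?S A)" using * by (rule mult_le_mono2)
      also have "\<dots> \<le> K * ?S A" by (simp add: K_def del: power_Suc)
      finally show ?thesis .
    qed
  qed
  show ?thesis
  proof (intro exI[of _ "1 / real K"] conjI allI impI)
    have K0: "real K > 0" by (simp add: K_def del: of_nat_Suc)
    then show "1 / real K > 0" by simp
    fix A :: "complex set" assume "finite A"
    then have "real (card A ^ k) \<le> real (K * ?S A)" using main of_nat_mono by blast
    then show "real (card (sumset (4 ^ (k - 1)) (prodset k A))) \<ge> 1 / real K * real (card A) ^ k"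
      using K0 by (simp add: k field_simps del: sumset.simps prodset.simps power_Suc)
  qed
qed

end
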